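(* Let $K$ be an algebraically closed field of characteristic zero. Let $S\le\mathfrak I_n$ be a transitive partial permutation inverse semigroup. Let $e\in E(S)$ be an idempotent with associated maximal subgroup $G_e$. Let $\chi\in\mathrm{Irr}(G_e)$ and let $\theta$ be the character of the rook matrix representation of $S$ over $K$ (that is, the fixed-point character). Then \[(\chi,\theta)_S=\begin{cases}(\chi,\theta|_{G_e})_{G_e}&\text{if } e \text{ has minimal non-zero rank},\\ 0&\text{otherwise.}\end{cases}\] Moreover, all idempotents of $S$ of minimal non-zero rank are isomorphic.
   Context: $[n]=\{1,\dots,n\}$; $\mathfrak I_n$ is the monoid of all partial permutations of $[n]$ (bijections between subsets, including the empty one), acting on the right. An inverse semigroup $S\le\mathfrak I_n$ is a subsemigroup closed under inverses; it is transitive if for all $i,j\in[n]$ there is $s\in S$ with $is=j$. The rank of $s$ is the cardinality of its range; minimal non-zero rank means smallest among the non-zero ranks of elements of $S$. $E(S)$ is the set of idempotents of $S$ (partial identities), ordered by restriction, with M\"obius function $\mu$. Idempotents $e,f\in E(S)$ are isomorphic if some $s\in S$ has $ss^{-1}=e$ and $s^{-1}s=f$. The maximal subgroup at $e$ is $G_e=\{s\in S: ss^{-1}=e=s^{-1}s\}$; $\mathrm{Irr}(G_e)$ is the set of its irreducible characters over $K$. The rook matrix representation of $S$ sends $\sigma$ to the $n\times n$ matrix with $(i,j)$ entry $1$ if $i\sigma=j$ and $0$ otherwise; its character is $\theta(s)=|\{i\in[n]: is=i\}|$. For functions on a finite group $G$, $(\psi,\alpha)_G=\frac1{|G|}\sum_{g\in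 G}\psi(g^{-1})\alpha(g)$. For a character $\theta$ of $S$, put $\theta_f(s)=\theta(fs)$ and \[(\chi,\theta)_S=\sum_{f\in E(S),\,f\le e}(\chi,\theta_f)_{G_e}\,\mu(f,e).\] *)

theory Defs
  imports
    "HOL-Algebra.Group"
    "HOL-Computational_Algebra.Polynomial"
    "Jordan_Normal_Form.VS_Connect"
begin

definition partial_perms :: "nat \<Rightarrow> (nat \<rightharpoonup> nat) set" where
  "partial_perms n = {s. dom s \<subseteq> {1..n} \<and> ran s \<subseteq> {1..n} \<and> inj_on s (dom s)}"

text \<open>Partial permutations act on the right: \<open>s \<cdot> t\<close> applies \<open>s\<close> first.\<close>

definition pp_mult :: "('a \<rightharpoonup> 'a) \<Rightarrow> ('a \<rightharpoonup> 'a) \<Rightarrow> ('a \<rightharpoonup> 'a)" (infixl "\<cdot>\<^sub>p" 70) where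
  "s \<cdot>\<^sub>p t = t \<circ>\<^sub>m s"

definition pp_inv :: "('a \<rightharpoonup> 'a) \<Rightarrow> ('a \<rightharpoonup> 'a)" where
  "pp_inv s = (\<lambda>j. if j \<in> ran s then Some (THE i. s i = Some j) else None)"

definition pp_rank :: "('a \<rightharpoonup> 'a) \<Rightarrow> nat" where
  "pp_rank s = card (ran s)"

definition pp_inverse_semigroup :: "nat \<Rightarrow> (nat \<rightharpoonup> nat) set \<Rightarrow> bool" where
  "pp_inverse_semigroup n S \<longleftrightarrow>
     S \<subseteq> partial_perms n \<and> (\<forall>s\<in>S. \<forall>t\<in>S. s \<cdot>\<^sub>p t \<in> S) \<and> (\<forall>s\<in>S. pp_inv s \<in> S)"

definition pp_transitive :: "nat \<Rightarrow> (nat \<rightharpoonup> nat) set \<Rightarrow> bool" where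
  "pp_transitive n S \<longleftrightarrow> (\<forall>i\<in>{1..n}. \<forall>j\<in>{1..n}. \<exists>s\<in>S. s i = Some j)"

definition idempotents :: "('a \<rightharpoonup> 'a) set \<Rightarrow> ('a \<rightharpoonup> 'a) set" where
  "idempotents S = {e \<in> S. e \<cdot>\<^sub>p e = e}"

definition has_min_nonzero_rank :: "('a \<rightharpoonup> 'a) set \<Rightarrow> ('a \<rightharpoonup> 'a) \<Rightarrow> bool" where
  "has_min_nonzero_rank S s \<longleftrightarrow>
     s \<in> S \<and> pp_rank s \<noteq> 0 \<and> (\<forall>t\<in>S. pp_rank t \<noteq> 0 \<longrightarrow> pp_rank s \<le> pp_rank t)"

definition isomorphic_idempotents :: "('a \<rightharpoonup> 'a) set \<Rightarrow> ('a \<rightharpoonup> 'a) \<Rightarrow> ('a \<rightharpoonup> 'a) \<Rightarrow> bool" where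
  "isomorphic_idempotents S e f \<longleftrightarrow> (\<exists>s\<in>S. s \<cdot>\<^sub>p pp_inv s = e \<and> pp_inv s \<cdot>\<^sub>p s = f)"

definition max_subgroup :: "('a \<rightharpoonup> 'a) set \<Rightarrow> ('a \<rightharpoonup> 'a) \<Rightarrow> ('a \<rightharpoonup> 'a) monoid" where
  "max_subgroup S e =
     \<lparr>carrier = {s \<in> S. s \<cdot>\<^sub>p pp_inv s = e \<and> pp_inv s \<cdot>\<^sub>p s = e}, mult = (\<cdot>\<^sub>p), one = e\<rparr>"

text \<open>
  The Moebius function of a finite set of partial maps ordered by restriction \<open>\<subseteq>\<^sub>m\<close>:
  \<open>\<mu>(x, x) = 1\<close>, and \<open>\<mu>(x, y)\<close> is minus the sum of \<open>\<mu>(x, z)\<close> over \<open>x \<le> z < y\<close> when \<open>x < y\<close>.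
  The guard makes the recursion terminate; off the order relation of \<open>P\<close> the value is \<open>0\<close>.
\<close>

function moebius :: "('a \<rightharpoonup> 'b) set \<Rightarrow> ('a \<rightharpoonup> 'b) \<Rightarrow> ('a \<rightharpoonup> 'b) \<Rightarrow> int" where
  "moebius P x y =
     (if finite P \<and> x \<in> P \<and> y \<in> P \<and> x \<subseteq>\<^sub>m y then
        if x = y then 1
        else - (\<Sum>z\<in>{z \<in> P. x \<subseteq>\<^sub>m z \<and> z \<subseteq>\<^sub>m y \<and> z \<noteq> y}. moebius P x z)
      else 0)"
  by pat_completeness auto

termination
proof (relation "measure (\<lambda>(P, x, y). card {z \<in> P. z \<subseteq>\<^sub>m y})", goal_cases)
  case 1
  then show ?case by simp
next
  case (2 P x y z)
  then have "{w \<in> P. w \<subseteq>\<^sub>m z} \<subset> {w \<in> P. w \<subseteq>\<^sub>m y}"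
    by (auto intro: map_le_trans map_le_antisym)
  moreover have "finite {w \<in> P. w \<subseteq>\<^sub>m y}"
    using 2 by simp
  ultimately show ?case
    by (simp add: psubset_card_mono)
qed

declare moebius.simps [simp del]

definition mat_trace :: "'k :: comm_monoid_add mat \<Rightarrow> 'k" where
  "mat_trace A = (\<Sum>i<dim_row A. A $$ (i, i))"

definition GL :: "'k :: semiring_1 itself \<Rightarrow> nat \<Rightarrow> 'k mat monoid" where
  "GL ty d = units_of (ring_mat ty d ())"

definition irreducible_rep ::
    "('g, 'b) monoid_scheme \<Rightarrow> nat \<Rightarrow> ('g \<Rightarrow> 'k :: field mat) \<Rightarrow> bool" where
  "irreducible_rep G d \<rho> \<longleftrightarrow>
     \<rho> \<in> hom G (GL TYPE('k) d) \<and> d > 0 \<and>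
     (\<forall>W. subspace class_ring W (module_vec TYPE('k) d) \<longrightarrow>
          (\<forall>g\<in>carrier G. \<forall>w\<in>W. \<rho> g *\<^sub>v w \<in> W) \<longrightarrow>
          W = {0\<^sub>v d} \<or> W = carrier_vec d)"

definition Irr :: "('g, 'b) monoid_scheme \<Rightarrow> ('g \<Rightarrow> 'k :: field) set" where
  "Irr G = {(\<lambda>g\<in>carrier G. mat_trace (\<rho> g)) | \<rho> d. irreducible_rep G d \<rho>}"

definition group_inner ::
    "('g, 'b) monoid_scheme \<Rightarrow> ('g \<Rightarrow> 'k :: field) \<Rightarrow> ('g \<Rightarrow> 'k) \<Rightarrow> 'k" where
  "group_inner G \<psi> \<alpha> = 1 / of_nat (card (carrier G)) * (\<Sum>g\<in>carrier G. \<psi> (inv\<^bsub>G\<^esub> g) * \<alpha> g)"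

definition semigroup_inner ::
    "('a \<rightharpoonup> 'a) set \<Rightarrow> ('a \<rightharpoonup> 'a) \<Rightarrow> (('a \<rightharpoonup> 'a) \<Rightarrow> 'k :: field) \<Rightarrow> (('a \<rightharpoonup> 'a) \<Rightarrow> 'k) \<Rightarrow> 'k" where
  "semigroup_inner S e \<chi> \<theta> =
     (\<Sum>f\<in>{f \<in> idempotents S. f \<subseteq>\<^sub>m e}.
        group_inner (max_subgroup S e) \<chi> (\<lambda>s. \<theta> (f \<cdot>\<^sub>p s)) * of_int (moebius (idempotents S) f e))"

text \<open>Matrix indices start at \<open>0\<close>, so row \<open>i\<close> belongs to the point \<open>Suc i\<close> of \<open>{1..n}\<close>.\<close>

definition rook_matrix :: "nat \<Rightarrow> (nat \<rightharpoonup> nat) \<Rightarrow> 'k :: semiring_1 mat" where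
  "rook_matrix n s = mat n n (\<lambda>(i, j). if s (Suc i) = Some (Suc j) then 1 else 0)"

definition rook_character :: "nat \<Rightarrow> (nat \<rightharpoonup> nat) \<Rightarrow> 'k :: semiring_1" where
  "rook_character n s = mat_trace (rook_matrix n s)"

lemma rook_character_eq_fixed_points:
  "rook_character n s = (of_nat (card {i \<in> {1..n}. s i = Some i}) :: 'k :: semiring_1)"
proof -
  have "{i \<in> {1..n}. s i = Some i} = Suc ` {i \<in> {..<n}. s (Suc i) = Some (Suc i)}"
    by (auto simp: image_iff Suc_le_eq gr0_conv_Suc)
  then have "card {i \<in> {1..n}. s i = Some i} = card {i \<in> {..<n}. s (Suc i) = Some (Suc i)}"
    by (simp add: card_image)
  then show ?thesis
    by (simp add: rook_character_def mat_trace_def rook_matrix_def sum.If_cases Int_def)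
qed

end

theory Submission
  imports Defs
begin

text \<open>
  Idempotents of \<open>S\<close> are partial identities, hence determined by their domains, and they are closed
  under intersection. Interchanging the sums in \<open>(\<chi>, \<theta>)\<^sub>S\<close>, the coefficient of \<open>\<chi>(g\<^sup>-\<^sup>1)\<close> becomes,
  up to the factor \<open>1/|G\<^sub>e|\<close>, a sum over the fixed points \<open>i\<close> of \<open>g\<close>, in which \<open>i\<close> contributes
  the sum of \<open>\<mu>(f, e)\<close> over all idempotents \<open>f \<le> e\<close> defined at \<open>i\<close>. There is a least
  idempotent \<open>m\<^sub>i\<close> defined at \<open>i\<close>, so this inner sum runs over the interval from \<open>m\<^sub>i\<close> to \<open>e\<close>, and
  Moebius inversion makes it \<open>1\<close> if \<open>m\<^sub>i = e\<close> and \<open>0\<close> otherwise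
  (\<open>sum_moebius_idempotents_at\<close>).

  Transitivity enters by showing that \<open>m\<^sub>i\<close> always has minimal non-zero rank
  (\<open>least_idempotent_at_has_min_nonzero_rank\<close>): any non-zero \<open>t\<close> can be precomposed with
  some \<open>s\<close> so that \<open>st\<close> is defined at \<open>i\<close>; then \<open>m\<^sub>i\<close> lies below the domain idempotent of \<open>st\<close>,
  whose rank is at most that of \<open>t\<close>. Consequently \<open>m\<^sub>i = e\<close> holds for every \<open>i\<close> in the domain of
  \<open>e\<close> when \<open>e\<close> has minimal non-zero rank, and for no such \<open>i\<close> otherwise. In the first case the
  coefficient is the number of fixed points of \<open>g\<close>, in the second it is \<open>0\<close>. So already before
  pairing with \<open>\<chi>\<close> the function \<open>g \<mapsto> \<Sum>\<^sub>f \<theta>(fg) \<mu>(f, e)\<close> equals \<open>\<theta>\<close> or \<open>0\<close> pointwise on \<open>G\<^sub>e\<close>.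

  For the isomorphism of two idempotents \<open>e\<close>, \<open>f\<close> of minimal non-zero rank, choose \<open>s\<close> carrying a
  point of \<open>e\<close> to a point of \<open>f\<close>; by minimality \<open>esf\<close> loses no points on either side.
\<close>

section \<open>The Moebius function summed over its lower argument\<close>

lemma moebius_refl: "finite P \<Longrightarrow> x \<in> P \<Longrightarrow> moebius P x x = 1"
  by (subst moebius.simps) simp

lemma moebius_less:
  assumes "finite P" "x \<in> P" "y \<in> P" "x \<subseteq>\<^sub>m y" "x \<noteq> y"
  shows "moebius P x y = - (\<Sum>z\<in>{z \<in> P. x \<subseteq>\<^sub>m z \<and> z \<subseteq>\<^sub>m y \<and> z \<noteq> y}. moebius P x z)"
  using assms by (subst moebius.simps) simp

text \<open>
  The recursion for \<open>\<mu>\<close> says that \<open>\<mu>\<close> is a one-sided inverse of the zeta function in the incidence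
  algebra; this is the statement that it is also an inverse on the other side. It follows by
  induction on the upper end: expanding each \<open>\<mu>(f, y)\<close> by the recursion and interchanging sums
  expresses the sum for \<open>y\<close> through the sums for all \<open>z < y\<close>, of which only \<open>z = x\<close> contributes.
\<close>

lemma sum_moebius_interval:
  assumes fin: "finite P" and x: "x \<in> P" and "y \<in> P" "x \<subseteq>\<^sub>m y"
  shows "(\<Sum>f\<in>{f \<in> P. x \<subseteq>\<^sub>m f \<and> f \<subseteq>\<^sub>m y}. moebius P f y) = (if x = y then 1 else 0)"
  using assms(3,4)
proof (induction "card {w \<in> P. w \<subseteq>\<^sub>m y}" arbitrary: y rule: less_induct)
  case less
  show ?case
  proof (cases "x = y")
    case True
    then have "{f \<in> P. x \<subseteq>\<^sub>m f \<and> f \<subseteq>\<^sub>m y} = {y}"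
      using less.prems by (auto intro: map_le_antisym)
    then show ?thesis
      using True fin less.prems by (simp add: moebius_refl)
  next
    case False
    define B where "B = {z \<in> P. x \<subseteq>\<^sub>m z \<and> z \<subseteq>\<^sub>m y \<and> z \<noteq> y}"
    have finB: "finite B"
      using fin by (simp add: B_def)
    have xB: "x \<in> B"
      using x less.prems False by (simp add: B_def)
    have IH: "(\<Sum>f\<in>{f \<in> P. x \<subseteq>\<^sub>m f \<and> f \<subseteq>\<^sub>m z}. moebius P f z) = (if x = z then 1 else 0)"
      if "z \<in> B" for z
    proof (rule less.hyps)
      have "{w \<in> P. w \<subseteq>\<^sub>m z} \<subset> {w \<in> P. w \<subseteq>\<^sub>m y}"
        using that less.prems by (auto simp: B_def intro: map_le_trans map_le_antisym)
      then show "card {w \<in> P. w \<subseteq>\<^sub>m z} < card {w \<in> P. w \<subseteq>\<^sub>m y}"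
        using fin by (simp add: psubset_card_mono)
    qed (use that in \<open>auto simp: B_def\<close>)
    have "{f \<in> P. x \<subseteq>\<^sub>m f \<and> f \<subseteq>\<^sub>m y} = insert y B" "y \<notin> B"
      using less.prems by (auto simp: B_def)
    then have "(\<Sum>f\<in>{f \<in> P. x \<subseteq>\<^sub>m f \<and> f \<subseteq>\<^sub>m y}. moebius P f y)
        = 1 + (\<Sum>f\<in>B. moebius P f y)"
      using finB fin less.prems by (simp add: moebius_refl)
    also have "(\<Sum>f\<in>B. moebius P f y) = (\<Sum>f\<in>B. - (\<Sum>z\<in>{z \<in> B. f \<subseteq>\<^sub>m z}. moebius P f z))"
    proof (rule sum.cong[OF refl])
      fix f assume f: "f \<in> B"
      then have "{z \<in> P. f \<subseteq>\<^sub>m z \<and> z \<subseteq>\<^sub>m y \<and> z \<noteq> y} = {z \<in> B. f \<subseteq>\<^sub>m z}"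
        by (auto simp: B_def intro: map_le_trans)
      then show "moebius P f y = - (\<Sum>z\<in>{z \<in> B. f \<subseteq>\<^sub>m z}. moebius P f z)"
        using f fin less.prems by (simp add: moebius_less B_def)
    qed
    also have "\<dots> = - (\<Sum>z\<in>B. \<Sum>f\<in>{f \<in> B. f \<subseteq>\<^sub>m z}. moebius P f z)"
      unfolding sum_negf by (subst sum.swap_restrict[OF finB finB]) simp
    also have "(\<Sum>z\<in>B. \<Sum>f\<in>{f \<in> B. f \<subseteq>\<^sub>m z}. moebius P f z) = (\<Sum>z\<in>B. if x = z then 1 else 0)"
    proof (rule sum.cong[OF refl])
      fix z assume z: "z \<in> B"
      then have "{f \<in> B. f \<subseteq>\<^sub>m z} = {f \<in> P. x \<subseteq>\<^sub>m f \<and> f \<subseteq>\<^sub>m z}"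
        by (auto simp: B_def intro: map_le_trans map_le_antisym)
      then show "(\<Sum>f\<in>{f \<in> B. f \<subseteq>\<^sub>m z}. moebius P f z) = (if x = z then 1 else 0)"
        using IH[OF z] by simp
    qed
    also have "\<dots> = 1"
      using finB xB by simp
    finally show ?thesis
      using False by simp
  qed
qed

section \<open>Partial permutations and their idempotents\<close>

lemma pp_mult_eq_Some_iff: "(s \<cdot>\<^sub>p t) x = Some z \<longleftrightarrow> (\<exists>y. s x = Some y \<and> t y = Some z)"
  by (simp add: pp_mult_def map_comp_Some_iff)

lemma pp_inv_eq_Some_iff:
  assumes "inj_on s (dom s)"
  shows "pp_inv s j = Some i \<longleftrightarrow> s i = Some j"
proof -
  have "(THE i. s i = Some j) = i" if "s i = Some j" for i
    using that assms by (auto intro!: the_equality simp: inj_on_def dom_def)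
  then show ?thesis
    by (auto simp: pp_inv_def ran_def)
qed

lemma pp_mult_pp_inv_eq_Some_iff:
  assumes "inj_on s (dom s)"
  shows "(s \<cdot>\<^sub>p pp_inv s) x = Some y \<longleftrightarrow> x \<in> dom s \<and> y = x"
    and "(pp_inv s \<cdot>\<^sub>p s) x = Some y \<longleftrightarrow> x \<in> ran s \<and> y = x"
  using assms
  by (auto simp: pp_mult_eq_Some_iff pp_inv_eq_Some_iff inj_on_def dom_def ran_def)

lemma map_eqI_Some: "(\<And>x y. f x = Some y \<longleftrightarrow> g x = Some y) \<Longrightarrow> f = g"
  by (rule ext) (metis not_None_eq)

lemma card_dom_eq_pp_rank:
  assumes "inj_on s (dom s)"
  shows "card (dom s) = pp_rank s"
proof -
  have "inj_on (\<lambda>x. the (s x)) (dom s)"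
    using assms by (auto simp: inj_on_def dom_def)
  moreover have "ran s = (\<lambda>x. the (s x)) ` dom s"
    by (force simp: ran_def dom_def)
  ultimately show ?thesis
    by (simp add: pp_rank_def card_image)
qed

lemma finite_partial_perms: "finite (partial_perms n)"
proof (rule finite_subset)
  show "partial_perms n \<subseteq> (\<Union>A\<in>Pow {1..n}. {s. dom s = A \<and> ran s \<subseteq> {1..n}})"
    by (auto simp: partial_perms_def)
  show "finite (\<Union>A\<in>Pow {1..n}. {s. dom s = A \<and> ran s \<subseteq> {1..n}})"
    by (auto intro!: finite_set_of_finite_maps intro: finite_subset)
qed

context
  fixes n :: nat and S :: "(nat \<rightharpoonup> nat) set"
  assumes S: "pp_inverse_semigroup n S"
begin

lemma inj_on_dom: "s \<in> S \<Longrightarrow> inj_on s (dom s)"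
  using S by (auto simp: pp_inverse_semigroup_def partial_perms_def)

lemma pp_mult_closed: "s \<in> S \<Longrightarrow> t \<in> S \<Longrightarrow> s \<cdot>\<^sub>p t \<in> S"
  using S by (simp add: pp_inverse_semigroup_def)

lemma pp_inv_closed: "s \<in> S \<Longrightarrow> pp_inv s \<in> S"
  using S by (simp add: pp_inverse_semigroup_def)

lemma dom_subset: "s \<in> S \<Longrightarrow> dom s \<subseteq> {1..n}"
  using S by (auto simp: pp_inverse_semigroup_def partial_perms_def)

lemma ran_subset: "s \<in> S \<Longrightarrow> ran s \<subseteq> {1..n}"
  using S by (auto simp: pp_inverse_semigroup_def partial_perms_def)

lemma finite_dom: "s \<in> S \<Longrightarrow> finite (dom s)"
  using dom_subset finite_subset by blast

lemma finite_ran: "s \<in> S \<Longrightarrow> finite (ran s)"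
  using ran_subset finite_subset by blast

lemma finite_idempotents: "finite (idempotents S)"
proof -
  have "idempotents S \<subseteq> partial_perms n"
    using S by (auto simp: idempotents_def pp_inverse_semigroup_def)
  then show ?thesis
    using finite_partial_perms finite_subset by blast
qed

lemma idempotent_in: "e \<in> idempotents S \<Longrightarrow> e \<in> S"
  by (simp add: idempotents_def)

text \<open>
  From \<open>e x = Some y\<close> and \<open>ee = e\<close> one gets \<open>e y = Some y\<close>, and injectivity forces \<open>x = y\<close>.
\<close>

lemma idempotent_eq_Some_iff:
  assumes "e \<in> idempotents S"
  shows "e x = Some y \<longleftrightarrow> x \<in> dom e \<and> y = x"
proof -
  have "y = x" if "e x = Some y" for y
  proof -
    have "(e \<cdot>\<^sub>p e) x = Some y"
      using assms that by (simp add: idempotents_def)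
    then have "e y = e x"
      using that by (auto simp: pp_mult_eq_Some_iff)
    then show "y = x"
      using that inj_on_dom[OF idempotent_in[OF assms]] by (auto simp: inj_on_def dom_def)
  qed
  then show ?thesis
    by (auto simp: dom_def)
qed

lemma idempotentI:
  assumes "e \<in> S" "\<And>x y. e x = Some y \<longleftrightarrow> x \<in> A \<and> y = x"
  shows "e \<in> idempotents S" "dom e = A"
proof -
  have "e \<cdot>\<^sub>p e = e"
    by (rule map_eqI_Some) (auto simp: pp_mult_eq_Some_iff assms(2))
  then show "e \<in> idempotents S"
    using assms(1) by (simp add: idempotents_def)
  show "dom e = A"
    using assms(2) by blast
qed

lemma idempotent_le_iff:
  assumes "e \<in> idempotents S" "f \<in> idempotents S"
  shows "f \<subseteq>\<^sub>m e \<longleftrightarrow> dom f \<subseteq> dom e"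
proof
  assume "dom f \<subseteq> dom e"
  then have "f x = Some x" "e x = Some x" if "x \<in> dom f" for x
    using that assms[THEN idempotent_eq_Some_iff, of x x] by blast+
  then show "f \<subseteq>\<^sub>m e"
    by (simp add: map_le_def)
qed (rule map_le_implies_dom_le)

lemma idempotent_eqI:
  assumes "e \<in> idempotents S" "f \<in> idempotents S" "dom e = dom f"
  shows "e = f"
  using assms by (intro map_eqI_Some) (simp add: idempotent_eq_Some_iff)

lemma pp_mult_idempotents:
  assumes "e \<in> idempotents S" "f \<in> idempotents S"
  shows "e \<cdot>\<^sub>p f \<in> idempotents S" "dom (e \<cdot>\<^sub>p f) = dom e \<inter> dom f"
proof -
  have "(e \<cdot>\<^sub>p f) x = Some y \<longleftrightarrow> x \<in> dom e \<inter> dom f \<and> y = x" for x y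
    using assms[THEN idempotent_eq_Some_iff] by (simp add: pp_mult_eq_Some_iff conj_assoc)
  then show "e \<cdot>\<^sub>p f \<in> idempotents S" "dom (e \<cdot>\<^sub>p f) = dom e \<inter> dom f"
    using idempotentI[OF pp_mult_closed[OF assms[THEN idempotent_in]]] by blast+
qed

lemma pp_mult_pp_inv_idempotent:
  assumes "s \<in> S"
  shows "s \<cdot>\<^sub>p pp_inv s \<in> idempotents S" "dom (s \<cdot>\<^sub>p pp_inv s) = dom s"
    and "pp_inv s \<cdot>\<^sub>p s \<in> idempotents S" "dom (pp_inv s \<cdot>\<^sub>p s) = ran s"
proof -
  note inv = pp_inv_closed[OF assms]
  note Some_iff = pp_mult_pp_inv_eq_Some_iff[OF inj_on_dom[OF assms]]
  show "s \<cdot>\<^sub>p pp_inv s \<in> idempotents S" "dom (s \<cdot>\<^sub>p pp_inv s) = dom s"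
    by (rule idempotentI[OF pp_mult_closed[OF assms inv] Some_iff(1)])+
  show "pp_inv s \<cdot>\<^sub>p s \<in> idempotents S" "dom (pp_inv s \<cdot>\<^sub>p s) = ran s"
    by (rule idempotentI[OF pp_mult_closed[OF inv assms] Some_iff(2)])+
qed

section \<open>Least idempotents and minimal non-zero rank\<close>

text \<open>
  The product of two idempotents defined at \<open>i\<close> is their meet and is again defined at \<open>i\<close>, so an
  idempotent with the fewest points among those defined at \<open>i\<close> lies below all of them.
\<close>

lemma least_idempotent_at:
  assumes "e \<in> idempotents S" "i \<in> dom e"
  obtains m where "m \<in> idempotents S" "i \<in> dom m"
    "\<And>f. f \<in> idempotents S \<Longrightarrow> i \<in> dom f \<Longrightarrow> m \<subseteq>\<^sub>m f"
proof -
  obtain m where m: "m \<in> idempotents S" "i \<in> dom m"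
    and min: "\<And>f. f \<in> idempotents S \<and> i \<in> dom f \<Longrightarrow> card (dom m) \<le> card (dom f)"
    using ex_has_least_nat[of "\<lambda>f. f \<in> idempotents S \<and> i \<in> dom f" e "\<lambda>f. card (dom f)"] assms
    by blast
  have "m \<subseteq>\<^sub>m f" if f: "f \<in> idempotents S" "i \<in> dom f" for f
  proof -
    note mf = pp_mult_idempotents[OF m(1) f(1)]
    have "card (dom m) \<le> card (dom m \<inter> dom f)"
      using min[of "m \<cdot>\<^sub>p f"] mf m f by simp
    then have "dom m \<inter> dom f = dom m"
      using finite_dom[OF idempotent_in[OF m(1)]] by (intro card_seteq) auto
    then show ?thesis
      using idempotent_le_iff[OF f(1) m(1)] by blast
  qed
  then show thesis
    using m that by blast
qed

text \<open>
  Because the idempotents defined at \<open>i\<close> form the up-set of the least one among them, those below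
  \<open>e\<close> form an interval and the Moebius function sums to an indicator.
\<close>

lemma sum_moebius_idempotents_at:
  assumes e: "e \<in> idempotents S" "i \<in> dom e"
    and m: "m \<in> idempotents S" "i \<in> dom m"
    and least: "\<And>f. f \<in> idempotents S \<Longrightarrow> i \<in> dom f \<Longrightarrow> m \<subseteq>\<^sub>m f"
  shows "(\<Sum>f\<in>{f \<in> idempotents S. f \<subseteq>\<^sub>m e \<and> i \<in> dom f}. moebius (idempotents S) f e)
    = (if m = e then 1 else 0)"
proof -
  have "{f \<in> idempotents S. f \<subseteq>\<^sub>m e \<and> i \<in> dom f} = {f \<in> idempotents S. m \<subseteq>\<^sub>m f \<and> f \<subseteq>\<^sub>m e}"
    using least m(2) map_le_implies_dom_le by blast
  then show ?thesis
    using sum_moebius_interval[OF finite_idempotents m(1) e(1) least[OF e]] by simp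
qed

lemma dom_eq_of_min_nonzero_rank:
  assumes "has_min_nonzero_rank S e" "s \<in> S" "dom s \<subseteq> dom e" "dom s \<noteq> {}"
  shows "dom s = dom e"
proof (rule card_seteq)
  have e: "e \<in> S"
    using assms(1) by (simp add: has_min_nonzero_rank_def)
  then show "finite (dom e)"
    by (rule finite_dom)
  have "card (dom s) \<noteq> 0"
    using assms finite_dom by simp
  then show "card (dom e) \<le> card (dom s)"
    using assms(1,2) card_dom_eq_pp_rank[OF inj_on_dom] e by (simp add: has_min_nonzero_rank_def)
qed (fact assms)

text \<open>
  Transitivity makes every non-zero \<open>t\<close> a competitor at the point \<open>i\<close>: some \<open>s\<close> moves \<open>i\<close> into the
  domain of \<open>t\<close>, and passing from \<open>t\<close> to \<open>st\<close> does not increase the rank.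
\<close>

lemma least_idempotent_at_has_min_nonzero_rank:
  assumes trans: "pp_transitive n S"
    and m: "m \<in> idempotents S" "i \<in> dom m"
    and least: "\<And>f. f \<in> idempotents S \<Longrightarrow> i \<in> dom f \<Longrightarrow> m \<subseteq>\<^sub>m f"
  shows "has_min_nonzero_rank S m"
proof -
  have mS: "m \<in> S"
    using m by (simp add: idempotent_in)
  have rank_m: "pp_rank m = card (dom m)"
    using card_dom_eq_pp_rank[OF inj_on_dom[OF mS]] by simp
  have "pp_rank m \<noteq> 0"
    using m(2) finite_dom[OF mS] by (auto simp: rank_m)
  moreover have "pp_rank m \<le> pp_rank t" if t: "t \<in> S" "pp_rank t \<noteq> 0" for t
  proof -
    obtain k j where k: "t k = Some j"
      using t(2) by (fastforce simp: pp_rank_def ran_def)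
    then have "i \<in> {1..n}" "k \<in> {1..n}"
      using m(2) dom_subset[OF mS] dom_subset[OF t(1)] by blast+
    then obtain s where s: "s \<in> S" "s i = Some k"
      using trans unfolding pp_transitive_def by blast
    have st: "s \<cdot>\<^sub>p t \<in> S"
      using s t by (simp add: pp_mult_closed)
    have i: "i \<in> dom (s \<cdot>\<^sub>p t)"
      using s(2) k by (auto intro!: domI simp: pp_mult_eq_Some_iff)
    note d = pp_mult_pp_inv_idempotent(1,2)[OF st]
    have "dom m \<subseteq> dom (s \<cdot>\<^sub>p t)"
      using map_le_implies_dom_le[OF least[OF d(1)]] i d(2) by simp
    then have "pp_rank m \<le> card (dom (s \<cdot>\<^sub>p t))"
      using finite_dom[OF st] by (simp add: rank_m card_mono)
    also have "\<dots> = card (ran (s \<cdot>\<^sub>p t))"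
      using card_dom_eq_pp_rank[OF inj_on_dom[OF st]] by (simp add: pp_rank_def)
    also have "\<dots> \<le> pp_rank t"
      unfolding pp_rank_def using finite_ran[OF t(1)]
      by (intro card_mono) (auto simp: ran_def pp_mult_eq_Some_iff)
    finally show ?thesis .
  qed
  ultimately show ?thesis
    using mS by (simp add: has_min_nonzero_rank_def)
qed

text \<open>
  Since the least idempotent at \<open>i\<close> lies below \<open>e\<close> and always has minimal non-zero rank, it equals
  \<open>e\<close> exactly when \<open>e\<close> has that rank too. The answer therefore no longer depends on \<open>i\<close>.
\<close>

lemma sum_moebius_idempotents_at_transitive:
  assumes trans: "pp_transitive n S" and e: "e \<in> idempotents S" "i \<in> dom e"
  shows "(\<Sum>f\<in>{f \<in> idempotents S. f \<subseteq>\<^sub>m e \<and> i \<in> dom f}. moebius (idempotents S) f e)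
    = (if has_min_nonzero_rank S e then 1 else 0)"
proof -
  obtain m where m: "m \<in> idempotents S" "i \<in> dom m"
    and least: "\<And>f. f \<in> idempotents S \<Longrightarrow> i \<in> dom f \<Longrightarrow> m \<subseteq>\<^sub>m f"
    using least_idempotent_at[OF e] by blast
  have "m = e" if "has_min_nonzero_rank S e"
  proof (rule idempotent_eqI[OF m(1) e(1)])
    show "dom m = dom e"
      using dom_eq_of_min_nonzero_rank[OF that idempotent_in[OF m(1)]] m(2)
        map_le_implies_dom_le[OF least[OF e]] by blast
  qed
  then have "m = e \<longleftrightarrow> has_min_nonzero_rank S e"
    using least_idempotent_at_has_min_nonzero_rank[OF trans m least] by blast
  then show ?thesis
    using sum_moebius_idempotents_at[OF e m least] by simp
qed

text \<open>
  If \<open>s\<close> sends a point of \<open>e\<close> to a point of \<open>f\<close>, then \<open>esf\<close> is non-zero with domain inside \<open>e\<close>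
  and range inside \<open>f\<close>; minimality of the two ranks turns both inclusions into equalities.
\<close>

lemma min_nonzero_rank_isomorphic:
  assumes trans: "pp_transitive n S"
    and e: "e \<in> idempotents S" "has_min_nonzero_rank S e"
    and f: "f \<in> idempotents S" "has_min_nonzero_rank S f"
  shows "isomorphic_idempotents S e f"
proof -
  have eS: "e \<in> S" and fS: "f \<in> S"
    using e f by (auto simp: idempotent_in)
  have "dom e \<noteq> {}" "dom f \<noteq> {}"
    using e(2) f(2) card_dom_eq_pp_rank[OF inj_on_dom[OF eS]]
      card_dom_eq_pp_rank[OF inj_on_dom[OF fS]] by (auto simp: has_min_nonzero_rank_def)
  then obtain i j where i: "i \<in> dom e" and j: "j \<in> dom f"
    by blast
  obtain s where s: "s \<in> S" "s i = Some j"
    using trans i j dom_subset[OF eS] dom_subset[OF fS] unfolding pp_transitive_def by blast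
  define u where "u = e \<cdot>\<^sub>p s \<cdot>\<^sub>p f"
  have u: "u \<in> S"
    using eS fS s by (simp add: u_def pp_mult_closed)
  have u_Some: "u x = Some y \<longleftrightarrow> x \<in> dom e \<and> s x = Some y \<and> y \<in> dom f" for x y
    using e(1) f(1) by (simp add: u_def pp_mult_eq_Some_iff idempotent_eq_Some_iff conj_ac)
  have uij: "u i = Some j"
    using i j s by (simp add: u_Some)
  note d = pp_mult_pp_inv_idempotent[OF u]
  have "dom u = dom e"
    using uij u_Some by (intro dom_eq_of_min_nonzero_rank[OF e(2) u]) blast+
  then have "u \<cdot>\<^sub>p pp_inv u = e"
    using d e(1) by (intro idempotent_eqI) auto
  moreover have "dom (pp_inv u \<cdot>\<^sub>p u) = dom f"
  proof (rule dom_eq_of_min_nonzero_rank[OF f(2) idempotent_in[OF d(3)]])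
    show "dom (pp_inv u \<cdot>\<^sub>p u) \<subseteq> dom f" "dom (pp_inv u \<cdot>\<^sub>p u) \<noteq> {}"
      using uij u_Some unfolding d(4) ran_def by blast+
  qed
  then have "pp_inv u \<cdot>\<^sub>p u = f"
    using d f(1) by (intro idempotent_eqI) auto
  ultimately show ?thesis
    using u by (auto simp: isomorphic_idempotents_def)
qed

section \<open>Multiplicities in the rook character\<close>

text \<open>
  Writing the number of fixed points of \<open>fg\<close> as a sum over the fixed points \<open>i\<close> of \<open>g\<close> in the domain
  of \<open>f\<close> and interchanging the sums leaves one Moebius sum for each \<open>i\<close>.
\<close>

lemma sum_moebius_rook_character:
  assumes trans: "pp_transitive n S" and e: "e \<in> idempotents S" and g: "g \<in> S" "dom g = dom e"
  shows "(\<Sum>f\<in>{f \<in> idempotents S. f \<subseteq>\<^sub>m e}.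
      rook_character n (f \<cdot>\<^sub>p g) * of_int (moebius (idempotents S) f e))
    = (if has_min_nonzero_rank S e then rook_character n g else (0 :: 'k :: comm_ring_1))"
proof -
  define E where "E = {f \<in> idempotents S. f \<subseteq>\<^sub>m e}"
  define F where "F = {i \<in> {1..n}. g i = Some i}"
  define \<mu> where "\<mu> = (\<lambda>f. moebius (idempotents S) f e)"
  have fin: "finite E" "finite F"
    using finite_idempotents by (simp_all add: E_def F_def)
  have fixes_fg: "{i \<in> {1..n}. (f \<cdot>\<^sub>p g) i = Some i} = {i \<in> F. i \<in> dom f}" if "f \<in> E" for f
    using that by (simp add: E_def F_def pp_mult_eq_Some_iff idempotent_eq_Some_iff conj_commute
        conj_left_commute)
  have "(\<Sum>f\<in>E. rook_character n (f \<cdot>\<^sub>p g) * of_int (\<mu> f))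
      = (\<Sum>f\<in>E. \<Sum>i\<in>{i \<in> F. i \<in> dom f}. of_int (\<mu> f) :: 'k)"
    by (intro sum.cong refl) (simp only: rook_character_eq_fixed_points fixes_fg sum_constant)
  also have "\<dots> = (\<Sum>i\<in>F. \<Sum>f\<in>{f \<in> E. i \<in> dom f}. of_int (\<mu> f))"
    by (rule sum.swap_restrict[OF fin])
  also have "\<dots> = (\<Sum>i\<in>F. of_int (if has_min_nonzero_rank S e then 1 else 0))"
  proof (rule sum.cong[OF refl])
    fix i assume "i \<in> F"
    then have "i \<in> dom e"
      using g(2) by (auto simp: F_def)
    then show "(\<Sum>f\<in>{f \<in> E. i \<in> dom f}. of_int (\<mu> f) :: 'k)
        = of_int (if has_min_nonzero_rank S e then 1 else 0)"
      using sum_moebius_idempotents_at_transitive[OF trans e, of i]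
      unfolding of_int_sum[symmetric] by (simp add: E_def \<mu>_def conj_assoc)
  qed
  also have "\<dots> = (if has_min_nonzero_rank S e then rook_character n g else 0)"
    by (simp add: rook_character_eq_fixed_points F_def)
  finally show ?thesis
    by (simp add: E_def \<mu>_def)
qed

lemma max_subgroup_dom:
  assumes "g \<in> carrier (max_subgroup S e)"
  shows "g \<in> S" "dom g = dom e"
  using assms pp_mult_pp_inv_idempotent(2)[of g] by (auto simp: max_subgroup_def)

lemma semigroup_inner_rook_character:
  fixes \<chi> :: "(nat \<rightharpoonup> nat) \<Rightarrow> 'k :: field"
  assumes trans: "pp_transitive n S" and e: "e \<in> idempotents S"
  shows "semigroup_inner S e \<chi> (rook_character n)
    = (if has_min_nonzero_rank S e
       then group_inner (max_subgroup S e) \<chi>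
         (restrict (rook_character n) (carrier (max_subgroup S e)))
       else 0)"
proof -
  define G where "G = max_subgroup S e"
  define E where "E = {f \<in> idempotents S. f \<subseteq>\<^sub>m e}"
  define \<mu> where "\<mu> = (\<lambda>f. of_int (moebius (idempotents S) f e) :: 'k)"
  define c where "c = 1 / (of_nat (card (carrier G)) :: 'k)"
  define \<psi> where "\<psi> = (\<lambda>g. \<chi> (inv\<^bsub>G\<^esub> g))"
  have "semigroup_inner S e \<chi> (rook_character n)
      = (\<Sum>f\<in>E. c * (\<Sum>g\<in>carrier G. \<psi> g * rook_character n (f \<cdot>\<^sub>p g)) * \<mu> f)"
    by (simp add: semigroup_inner_def group_inner_def G_def E_def \<mu>_def c_def \<psi>_def)
  also have "\<dots> = (\<Sum>f\<in>E. \<Sum>g\<in>carrier G. c * (\<psi> g * (rook_character n (f \<cdot>\<^sub>p g) * \<mu> f)))"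
    by (simp add: sum_distrib_left sum_distrib_right mult.assoc)
  also have "\<dots> = c * (\<Sum>g\<in>carrier G. \<psi> g * (\<Sum>f\<in>E. rook_character n (f \<cdot>\<^sub>p g) * \<mu> f))"
    by (subst sum.swap) (simp add: sum_distrib_left)
  also have "\<dots> = c * (\<Sum>g\<in>carrier G.
      \<psi> g * (if has_min_nonzero_rank S e then rook_character n g else 0))"
    using sum_moebius_rook_character[OF trans e max_subgroup_dom, where ?'k = 'k]
    by (simp add: G_def E_def \<mu>_def)
  finally show ?thesis
    by (simp add: group_inner_def G_def c_def \<psi>_def)
qed

end

theorem theorem6p7:
  fixes n :: nat
    and S :: "(nat \<rightharpoonup> nat) set"
    and \<theta> :: "(nat \<rightharpoonup> nat) \<Rightarrow> 'k :: {alg_closed_field, field_char_0}"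
  assumes "pp_inverse_semigroup n S"
    and "pp_transitive n S"
    and "\<theta> = rook_character n"
  shows "(\<forall>e\<in>idempotents S. \<forall>\<chi>\<in>Irr (max_subgroup S e).
            semigroup_inner S e \<chi> \<theta> =
              (if has_min_nonzero_rank S e
               then group_inner (max_subgroup S e) \<chi> (restrict \<theta> (carrier (max_subgroup S e)))
               else 0)) \<and>
         (\<forall>e\<in>idempotents S. \<forall>f\<in>idempotents S.
            has_min_nonzero_rank S e \<longrightarrow> has_min_nonzero_rank S f \<longrightarrow>
            isomorphic_idempotents S e f)"
  using semigroup_inner_rook_character[OF assms(1,2)] min_nonzero_rank_isomorphic[OF assms(1,2)]
  unfolding assms(3) by blast

end
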